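(* Let $k\ge 1$ be an integer. The average-case subjective privacy-approximation ratio, with respect to the uniform distribution on $\{0,\ldots,2^k-1\}^2$, of the Bisection Protocol applied to the Millionaires Problem on $k$-bit inputs equals $\frac{k}{2}+1$.
   Context: Communication model. Parties $1$ and $2$ hold private inputs $x_1,x_2\in\{0,\ldots,2^k-1\}$ respectively. In a deterministic protocol $P$ the parties exchange bits; the identity of the next sender is determined by the history of bits sent so far, and each bit is a function of the sender's own input and the history. The sequence of all bits sent on input $(x_1,x_2)$ is the transcript. $P$ is a protocol for a function $f$ if the transcript determines $f(x_1,x_2)$. For an input $(x_1,x_2)$ let $R^P(x_1,x_2)$ be the set of all inputs having the same transcript as $(x_1,x_2)$; it is a combinatorial rectangle on which $f$ is constant. Let $R^I(x_1,x_2)=\{(x_1',x_2'): f(x_1',x_2')=f(x_1,x_2)\}$. Subjective ratios. For $i=1$ put $R_1^P(x_1,x_2)=R^P(x_1,x_2)\cap(\{x_1\}\times\{0,\ldots,2^k-1\})$ and $R_1^I(x_1,x_2)=R^I(x_1,x_2)\cap(\{x_1\}\times\{0,\ldots,2^k-1\})$; for $i=2$ put $R_2^P(x_1,x_2)=R^P(x_1,x_2)\cap(\{0,\ldots,2^k-1\}\times\{x_2\})$ and $R_2^I(x_1,x_2)=R^I(x_1,x_2)\cap(\{0,\ldots,2^k-1\}\times\{x_2\})$. The average-case privacy-approximation ratio (PAR) of $P$ with respect to $i$ under a distribution $D$ on inputs is $E_D\big[|R_i^I(x_1,x_2)|/|R_i^P(x_1,x_2)|\big]$. The average-case subjective PAR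 of $P$ is the maximum over $i\in\{1,2\}$ of its average-case PAR with respect to $i$. Millionaires Problem: $f(x_1,x_2)=1$ if $x_1\ge x_2$ and $f(x_1,x_2)=2$ if $x_1<x_2$ (the identity of the party with the higher value, ties broken in favor of party $1$). Bisection Protocol: start with the interval $[0,2^k)$. At each step, with current interval $[a,a+2^m)$, $m\ge1$, known to contain both inputs, each of the two parties announces whether its value lies in the lower half $[a,a+2^{m-1})$ or the upper half $[a+2^{m-1},a+2^m)$. If the answers differ, stop: the party in the upper half has the higher value. If the answers agree, continue with the common half. If the answers never differ (until the interval has one element), the values are equal and party $1$ is declared the winner. *)

theory Defs
  imports "HOL-Probability.Probability_Mass_Function"
begin

datatype party = Party1 | Party2

primrec own :: "party \<Rightarrow> nat \<times> nat \<Rightarrow> nat" where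
  "own Party1 x = fst x"
| "own Party2 x = snd x"

definition inputs :: "nat \<Rightarrow> (nat \<times> nat) set" where
  "inputs k = {0..<2 ^ k} \<times> {0..<2 ^ k}"


text \<open>
  A deterministic protocol is a (well-founded) protocol tree. A position in the tree corresponds to
  a history of bits; hence both the next sender and the function computing that sender's next bit
  from its own input depend on the history. \<open>Send i m c\<close>: party \<open>i\<close> with input \<open>v\<close> sends the bit
  \<open>m v\<close>, and the protocol goes on as \<open>c (m v)\<close>. Nothing is attached to \<open>Halt\<close>: the result has
  to be determined by the transcript.
\<close>

datatype protocol = Halt | Send party "nat \<Rightarrow> bool" "bool \<Rightarrow> protocol"

primrec transcript :: "protocol \<Rightarrow> nat \<times> nat \<Rightarrow> bool list" where
  "transcript Halt x = []"
| "transcript (Send i m c) x = m (own i x) # transcript (c (m (own i x))) x"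

definition protocol_for :: "nat \<Rightarrow> protocol \<Rightarrow> (nat \<times> nat \<Rightarrow> 'o) \<Rightarrow> bool" where
  "protocol_for k P f \<longleftrightarrow> (\<exists>g. \<forall>x\<in>inputs k. f x = g (transcript P x))"


definition RP :: "nat \<Rightarrow> protocol \<Rightarrow> nat \<times> nat \<Rightarrow> (nat \<times> nat) set" where
  "RP k P x = {y \<in> inputs k. transcript P y = transcript P x}"

definition RI :: "nat \<Rightarrow> (nat \<times> nat \<Rightarrow> 'o) \<Rightarrow> nat \<times> nat \<Rightarrow> (nat \<times> nat) set" where
  "RI k f x = {y \<in> inputs k. f y = f x}"

primrec slice :: "nat \<Rightarrow> party \<Rightarrow> nat \<times> nat \<Rightarrow> (nat \<times> nat) set" where
  "slice k Party1 x = {fst x} \<times> {0..<2 ^ k}"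
| "slice k Party2 x = {0..<2 ^ k} \<times> {snd x}"

definition subjective_RP :: "nat \<Rightarrow> protocol \<Rightarrow> party \<Rightarrow> nat \<times> nat \<Rightarrow> (nat \<times> nat) set" where
  "subjective_RP k P i x = RP k P x \<inter> slice k i x"

definition subjective_RI ::
  "nat \<Rightarrow> (nat \<times> nat \<Rightarrow> 'o) \<Rightarrow> party \<Rightarrow> nat \<times> nat \<Rightarrow> (nat \<times> nat) set" where
  "subjective_RI k f i x = RI k f x \<inter> slice k i x"

text \<open>
  Both sets are finite and contain \<open>x\<close> whenever \<open>x \<in> inputs k\<close>, so for a distribution \<open>D\<close> supported
  on \<open>inputs k\<close> the denominator is positive almost surely.
\<close>

definition average_PAR ::
  "nat \<Rightarrow> (nat \<times> nat) pmf \<Rightarrow> (nat \<times> nat \<Rightarrow> 'o) \<Rightarrow> protocol \<Rightarrow> party \<Rightarrow> real" where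
  "average_PAR k D f P i = measure_pmf.expectation D
     (\<lambda>x. real (card (subjective_RI k f i x)) / real (card (subjective_RP k P i x)))"

definition average_subjective_PAR ::
  "nat \<Rightarrow> (nat \<times> nat) pmf \<Rightarrow> (nat \<times> nat \<Rightarrow> 'o) \<Rightarrow> protocol \<Rightarrow> real" where
  "average_subjective_PAR k D f P = (MAX i\<in>{Party1, Party2}. average_PAR k D f P i)"


definition millionaires :: "nat \<times> nat \<Rightarrow> party" where
  "millionaires x = (if fst x \<ge> snd x then Party1 else Party2)"

text \<open>
  \<open>bisection m a\<close> is the protocol run on the interval \<open>[a, a + 2 ^ m)\<close>. The bit \<open>True\<close> announces
  the upper half.
\<close>

primrec bisection :: "nat \<Rightarrow> nat \<Rightarrow> protocol" where
  "bisection 0 a = Halt"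
| "bisection (Suc m) a =
     Send Party1 (\<lambda>v. v \<ge> a + 2 ^ m) (\<lambda>b1.
     Send Party2 (\<lambda>v. v \<ge> a + 2 ^ m) (\<lambda>b2.
       if b1 = b2 then bisection m (if b1 then a + 2 ^ m else a) else Halt))"

definition bisection_protocol :: "nat \<Rightarrow> protocol" where
  "bisection_protocol k = bisection k 0"

lemma bisection_transcript_determines:
  assumes "x \<in> {a..<a + 2 ^ m} \<times> {a..<a + 2 ^ m}"
    and "y \<in> {a..<a + 2 ^ m} \<times> {a..<a + 2 ^ m}"
    and "transcript (bisection m a) x = transcript (bisection m a) y"
  shows "millionaires x = millionaires y"
  using assms
proof (induction m arbitrary: a)
  case 0
  then show ?case by (auto simp: millionaires_def)
next
  case (Suc m)
  let ?u = "\<lambda>v. v \<ge> a + 2 ^ m"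
  have eq: "?u (fst x) = ?u (fst y)" "?u (snd x) = ?u (snd y)"
    using Suc.prems(3) by auto
  show ?case
  proof (cases "?u (fst x) = ?u (snd x)")
    case True
    let ?a = "if ?u (fst x) then a + 2 ^ m else a"
    have "transcript (bisection m ?a) x = transcript (bisection m ?a) y"
      using Suc.prems(3) eq True by auto
    moreover have "x \<in> {?a..<?a + 2 ^ m} \<times> {?a..<?a + 2 ^ m}"
      "y \<in> {?a..<?a + 2 ^ m} \<times> {?a..<?a + 2 ^ m}"
      using Suc.prems(1,2) eq True by (auto simp: mem_Times_iff)
    ultimately show ?thesis by (intro Suc.IH)
  next
    case False
    then show ?thesis using eq by (auto simp: millionaires_def)
  qed
qed

lemma bisection_protocol_for_millionaires:
  "protocol_for k (bisection_protocol k) millionaires"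
proof -
  let ?t = "transcript (bisection_protocol k)"
  have "millionaires x = millionaires (inv_into (inputs k) ?t (?t x))" if "x \<in> inputs k" for x
    by (rule bisection_transcript_determines[where m = k and a = 0])
      (use that inv_into_into[of "?t x" ?t "inputs k"] f_inv_into_f[of "?t x" ?t "inputs k"]
        in \<open>auto simp: inputs_def bisection_protocol_def\<close>)
  then show ?thesis
    unfolding protocol_for_def
    by (intro exI[of _ "\<lambda>t. millionaires (inv_into (inputs k) ?t t)"]) blast
qed

end

theory Submission
  imports Defs
begin

text \<open>
  In the bisection of an interval of length \<open>2 ^ Suc m\<close>, the inputs on which the announcements
  differ form two off-diagonal squares, and within them each slice of a transcript class is a full
  half interval of \<open>2 ^ m\<close> values. The remaining inputs are two instances of the bisection of an
  interval of length \<open>2 ^ m\<close>. The sum of the subjective ratios hence satisfies a linear recursion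
  in \<open>m\<close>, which has a closed form because the numerators are affine in the own input as long as
  the winner is fixed.
\<close>

definition block :: "nat \<Rightarrow> nat \<Rightarrow> nat set" where
  "block m a = {a..<a + 2 ^ m}"

lemma finite_block [simp]: "finite (block m a)"
  and card_block [simp]: "card (block m a) = 2 ^ m"
  by (simp_all add: block_def)

lemma block_Suc: "block (Suc m) a = block m a \<union> block m (a + 2 ^ m)"
  by (auto simp: block_def)

lemma block_disjoint: "block m a \<inter> block m (a + 2 ^ m) = {}"
  by (auto simp: block_def)

lemma sum_block: "(\<Sum>x\<in>block m a. real x) = 2 ^ m * real a + 2 ^ m * (2 ^ m - 1) / 2"
proof (induction m arbitrary: a)
  case 0
  then show ?case by (simp add: block_def)
next
  case (Suc m)
  have "(\<Sum>x\<in>block (Suc m) a. real x) =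
      (\<Sum>x\<in>block m a. real x) + (\<Sum>x\<in>block m (a + 2 ^ m). real x)"
    unfolding block_Suc by (rule sum.union_disjoint) (simp_all add: block_disjoint)
  then show ?case by (simp add: Suc.IH field_simps)
qed

lemma sum_square_block_Suc:
  fixes h :: "nat \<times> nat \<Rightarrow> real"
  shows "sum h (block (Suc m) a \<times> block (Suc m) a) =
    sum h (block m a \<times> block m a) + sum h (block m (a + 2 ^ m) \<times> block m (a + 2 ^ m)) +
    (sum h (block m a \<times> block m (a + 2 ^ m)) + sum h (block m (a + 2 ^ m) \<times> block m a))"
proof -
  have split: "(\<Sum>x\<in>block (Suc m) a. g x) = (\<Sum>x\<in>block m a. g x) + (\<Sum>x\<in>block m (a + 2 ^ m). g x)"
    for g :: "nat \<Rightarrow> real"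
    unfolding block_Suc by (rule sum.union_disjoint) (simp_all add: block_disjoint)
  show ?thesis
    by (simp add: sum.cartesian_product' split sum.distrib)
qed

text \<open>Localizes \<open>subjective_RP\<close> to a subinterval, so that an induction over the
  bisection can follow it.\<close>

definition transcript_slice :: "party \<Rightarrow> nat \<Rightarrow> nat \<Rightarrow> nat \<times> nat \<Rightarrow> (nat \<times> nat) set" where
  "transcript_slice i m a x = {y \<in> block m a \<times> block m a.
     own i y = own i x \<and> transcript (bisection m a) y = transcript (bisection m a) x}"

text \<open>The first two bits of \<open>x\<close> are both \<open>False\<close>. Any
  \<open>y\<close> with the same transcript sends the same bits and so lies in the same diagonal
  square.\<close>

lemma transcript_slice_lower:
  assumes "x \<in> block m a \<times> block m a"
  shows "transcript_slice i (Suc m) a x = transcript_slice i m a x"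
  using assms by (auto simp: transcript_slice_def block_def)

lemma transcript_slice_upper:
  assumes "x \<in> block m (a + 2 ^ m) \<times> block m (a + 2 ^ m)"
  shows "transcript_slice i (Suc m) a x = transcript_slice i m (a + 2 ^ m) x"
  using assms by (auto simp: transcript_slice_def block_def)

text \<open>Differing announcements end the protocol, so the transcript reveals only the
  off-diagonal square. Fixing the own input leaves one side of that square.\<close>

lemma card_transcript_slice_lower_upper:
  assumes "x \<in> block m a \<times> block m (a + 2 ^ m)"
  shows "card (transcript_slice i (Suc m) a x) = 2 ^ m"
proof (cases i)
  case Party1
  then have "transcript_slice i (Suc m) a x = {fst x} \<times> block m (a + 2 ^ m)"
    using assms by (auto simp: transcript_slice_def block_def)
  then show ?thesis by simp
next
  case Party2
  then have "transcript_slice i (Suc m) a x = block m a \<times> {snd x}"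
    using assms by (auto simp: transcript_slice_def block_def)
  then show ?thesis by simp
qed

lemma card_transcript_slice_upper_lower:
  assumes "x \<in> block m (a + 2 ^ m) \<times> block m a"
  shows "card (transcript_slice i (Suc m) a x) = 2 ^ m"
proof (cases i)
  case Party1
  then have "transcript_slice i (Suc m) a x = {fst x} \<times> block m a"
    using assms by (auto simp: transcript_slice_def block_def)
  then show ?thesis by simp
next
  case Party2
  then have "transcript_slice i (Suc m) a x = block m (a + 2 ^ m) \<times> {snd x}"
    using assms by (auto simp: transcript_slice_def block_def)
  then show ?thesis by simp
qed

text \<open>The numerator is a parameter: it stays fixed in the recursion, while the denominators
  follow the block.\<close>

definition ratio_sum :: "(nat \<times> nat \<Rightarrow> real) \<Rightarrow> party \<Rightarrow> nat \<Rightarrow> nat \<Rightarrow> real" where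
  "ratio_sum w i m a = (\<Sum>x\<in>block m a \<times> block m a. w x / real (card (transcript_slice i m a x)))"

lemma ratio_sum_0: "ratio_sum w i 0 a = w (a, a)"
proof -
  have "block 0 a = {a}"
    by (auto simp: block_def)
  then have "transcript_slice i 0 a (a, a) = {(a, a)}"
    by (auto simp: transcript_slice_def)
  with \<open>block 0 a = {a}\<close> show ?thesis
    by (simp add: ratio_sum_def)
qed

lemma ratio_sum_Suc:
  "ratio_sum w i (Suc m) a = ratio_sum w i m a + ratio_sum w i m (a + 2 ^ m) +
    (sum w (block m a \<times> block m (a + 2 ^ m)) + sum w (block m (a + 2 ^ m) \<times> block m a)) / 2 ^ m"
  unfolding ratio_sum_def sum_square_block_Suc
  by (simp add: transcript_slice_lower transcript_slice_upper card_transcript_slice_lower_upper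
      card_transcript_slice_upper_lower sum_divide_distrib add_divide_distrib cong: sum.cong)

text \<open>
  For \<open>N = 2 ^ k\<close> these are the cardinalities of the ideal slices. A separate parameter \<open>N\<close> keeps
  them fixed while the length of the block varies.
\<close>

primrec winner_weight :: "real \<Rightarrow> party \<Rightarrow> nat \<times> nat \<Rightarrow> real" where
  "winner_weight N Party1 x = (if fst x \<ge> snd x then real (fst x) + 1 else N - 1 - real (fst x))"
| "winner_weight N Party2 x = (if fst x \<ge> snd x then N - real (snd x) else real (snd x))"

text \<open>The affine weights on the two squares have opposite slopes. Pairing an own input
  \<open>x\<close> in the lower half with \<open>x + 2 ^ m\<close> in the upper half gives
  \<open>N + 2 ^ m\<close> in total, independent of \<open>a\<close> and of the party.\<close>

lemma sum_winner_weight_off_diagonal: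
  "sum (winner_weight N i) (block m a \<times> block m (a + 2 ^ m)) +
   sum (winner_weight N i) (block m (a + 2 ^ m) \<times> block m a) = 2 ^ m * (2 ^ m * (N + 2 ^ m))"
proof -
  let ?L = "block m a" and ?U = "block m (a + 2 ^ m)"
  \<comment> \<open>This fixes the winner on each square and resolves the case distinction in
    \<open>winner_weight\<close>.\<close>
  have lt: "x < y" if "x \<in> ?L" "y \<in> ?U" for x y
    using that by (auto simp: block_def)
  show ?thesis
  proof (cases i)
    case Party1
    have "sum (winner_weight N i) (?L \<times> ?U) = (\<Sum>x\<in>?L. \<Sum>y\<in>?U. N - 1 - real x)"
      unfolding sum.cartesian_product using lt by (intro sum.cong) (fastforce simp: Party1)+
    also have "\<dots> = 2 ^ m * (2 ^ m * (N - 1) - (\<Sum>x\<in>?L. real x))"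
      by (simp add: sum_subtractf flip: sum_distrib_left)
    finally have LU: "sum (winner_weight N i) (?L \<times> ?U) = \<dots>" .
    have "sum (winner_weight N i) (?U \<times> ?L) = (\<Sum>x\<in>?U. \<Sum>y\<in>?L. real x + 1)"
      unfolding sum.cartesian_product using lt by (intro sum.cong) (fastforce simp: Party1)+
    also have "\<dots> = 2 ^ m * ((\<Sum>x\<in>?U. real x) + 2 ^ m)"
      by (simp add: sum.distrib flip: sum_distrib_left)
    finally show ?thesis
      unfolding LU by (simp add: sum_block algebra_simps)
  next
    case Party2
    have "sum (winner_weight N i) (?L \<times> ?U) = (\<Sum>x\<in>?L. \<Sum>y\<in>?U. real y)"
      unfolding sum.cartesian_product using lt by (intro sum.cong) (fastforce simp: Party2)+
    also have "\<dots> = 2 ^ m * (\<Sum>y\<in>?U. real y)"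
      by simp
    finally have LU: "sum (winner_weight N i) (?L \<times> ?U) = \<dots>" .
    have "sum (winner_weight N i) (?U \<times> ?L) = (\<Sum>x\<in>?U. \<Sum>y\<in>?L. N - real y)"
      unfolding sum.cartesian_product using lt by (intro sum.cong) (fastforce simp: Party2)+
    also have "\<dots> = 2 ^ m * (2 ^ m * N - (\<Sum>y\<in>?L. real y))"
      by (simp add: sum_subtractf)
    finally show ?thesis
      unfolding LU by (simp add: sum_block algebra_simps)
  qed
qed

text \<open>The leaves of the recursion contribute the diagonal sum, which is additive over halves.
  The rest solves \<open>T (Suc m) = 2 * T m + 2 ^ m * (N + 2 ^ m)\<close> with
  \<open>T 0 = 0\<close>.\<close>

lemma ratio_sum_winner_weight:
  "ratio_sum (winner_weight N i) i m a =
    (\<Sum>x\<in>block m a. winner_weight N i (x, x)) + 2 ^ m * (real m * N + 2 ^ m - 1) / 2"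
proof (induction m arbitrary: a)
  case 0
  then show ?case by (simp add: ratio_sum_0 block_def)
next
  case (Suc m)
  have "(\<Sum>x\<in>block (Suc m) a. winner_weight N i (x, x)) =
      (\<Sum>x\<in>block m a. winner_weight N i (x, x)) +
      (\<Sum>x\<in>block m (a + 2 ^ m). winner_weight N i (x, x))"
    unfolding block_Suc by (rule sum.union_disjoint) (simp_all add: block_disjoint)
  then show ?case
    by (simp add: ratio_sum_Suc sum_winner_weight_off_diagonal Suc.IH field_simps)
qed

lemma card_subjective_RI_millionaires:
  assumes "x \<in> inputs k"
  shows "real (card (subjective_RI k millionaires i x)) = winner_weight (2 ^ k) i x"
proof -
  obtain u v where x: "x = (u, v)" and u: "u < 2 ^ k" and v: "v < 2 ^ k"
    using assms by (auto simp: inputs_def)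
  have "real (2 ^ k - Suc u) = 2 ^ k - 1 - real u" "real (2 ^ k - v) = 2 ^ k - real v"
    using u v by (simp_all add: of_nat_diff)
  \<comment> \<open>Ties go to \<open>Party1\<close>, so the own value belongs to the slice exactly
    when \<open>Party1\<close> wins; hence \<open>u + 1\<close> elements in \<open>{..u}\<close> but
    only \<open>v\<close> in \<open>{..<v}\<close>.\<close>
  moreover have "subjective_RI k millionaires i x = (case i of
      Party1 \<Rightarrow> {u} \<times> (if v \<le> u then {..u} else {Suc u..<2 ^ k})
    | Party2 \<Rightarrow> (if v \<le> u then {v..<2 ^ k} else {..<v}) \<times> {v})"
    using u v
    by (cases i) (auto simp: x subjective_RI_def RI_def inputs_def millionaires_def split: if_splits)
  ultimately show ?thesis
    by (cases i) (simp_all add: x)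
qed

lemma inputs_eq_block: "inputs k = block k 0 \<times> block k 0"
  by (simp add: inputs_def block_def)

lemma subjective_RP_bisection:
  assumes "x \<in> inputs k"
  shows "subjective_RP k (bisection_protocol k) i x = transcript_slice i k 0 x"
  using assms
  by (cases i) (auto simp: subjective_RP_def RP_def transcript_slice_def bisection_protocol_def
      inputs_eq_block block_def)

lemma average_PAR_bisection:
  "average_PAR k (pmf_of_set (inputs k)) millionaires (bisection_protocol k) i = real k / 2 + 1"
proof -
  have "average_PAR k (pmf_of_set (inputs k)) millionaires (bisection_protocol k) i =
      (\<Sum>x\<in>inputs k. real (card (subjective_RI k millionaires i x)) /
        real (card (subjective_RP k (bisection_protocol k) i x))) / real (card (inputs k))"
    unfolding average_PAR_def
    by (rule integral_pmf_of_set) (auto simp: inputs_def)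
  also have "\<dots> = ratio_sum (winner_weight (2 ^ k) i) i k 0 / (2 ^ k * 2 ^ k)"
    by (simp add: card_subjective_RI_millionaires subjective_RP_bisection ratio_sum_def
        card_cartesian_product inputs_eq_block[symmetric] cong: sum.cong)
      (simp add: inputs_eq_block card_cartesian_product)
  \<comment> \<open>The diagonal weights are \<open>x + 1\<close> for \<open>Party1\<close> and
    \<open>2 ^ k - x\<close> for \<open>Party2\<close>; both run through the numbers from 1 to
    \<open>2 ^ k\<close>.\<close>
  also have "(\<Sum>x\<in>block k 0. winner_weight (2 ^ k) i (x, x)) = 2 ^ k * (2 ^ k + 1) / 2"
    by (cases i) (simp_all add: sum.distrib sum_subtractf sum_block field_simps)
  \<comment> \<open>The lower-order terms \<open>2 ^ k / 2\<close> cancel, leaving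
    \<open>2 ^ k * 2 ^ k * (k + 2) / 2\<close> in the numerator.\<close>
  then have "ratio_sum (winner_weight (2 ^ k) i) i k 0 / (2 ^ k * 2 ^ k) = real k / 2 + 1"
    by (simp add: ratio_sum_winner_weight field_simps)
  finally show ?thesis .
qed

theorem theorem4p2:
  fixes k :: nat
  assumes "k \<ge> 1"
  shows "average_subjective_PAR k (pmf_of_set (inputs k)) millionaires (bisection_protocol k)
           = real k / 2 + 1"
  \<comment> \<open>Both parties have the same average, so the maximum is over a single
    value.\<close>
  by (simp add: average_subjective_PAR_def average_PAR_bisection)

end
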